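(* Let $X$ be an ultrametric space. For every finite $Y\subseteq X$ there exists a finite $Z\subseteq X$ such that $Y\subseteq Z$, and every $X$-extendable partial isometry of $Y$ can be extended to an $X$-extendable isometry of $Z$. Moreover, if $|Y|>1$, then $Z$ can be chosen so that for every $z\in Z$ there is $y\in Y$ such that $d(z,y)<\mathrm{diam}(Y)$.
   Context: A metric space $(X,d)$ is ultrametric if $d(x,z)\le\max\{d(x,y),d(y,z)\}$ for all $x,y,z\in X$. An isometry of a metric space is a distance-preserving bijection of it onto itself. A partial isometry of $Y\subseteq X$ is an isometric bijection $f:A\to B$ with $A,B\subseteq Y$. A partial isometry is $X$-extendable if it can be extended to an isometry of the whole space $X$. An $X$-extendable isometry of $Z$ is an isometric bijection $Z\to Z$ that can be extended to an isometry of $X$. *)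

theory Defs
  imports "HOL-Analysis.Analysis"
begin

locale Ultrametric_space = Metric_space +
  assumes ultrametric: "\<lbrakk>x \<in> M; y \<in> M; z \<in> M\<rbrakk> \<Longrightarrow> d x z \<le> max (d x y) (d y z)"

text \<open>
  A map with domain \<open>A\<close> is represented by a total HOL function of which only the values
  on \<open>A\<close> matter; hence equality of maps is always stated relative to a domain.
\<close>

definition isometric_bij :: "('a \<Rightarrow> 'a \<Rightarrow> real) \<Rightarrow> 'a set \<Rightarrow> 'a set \<Rightarrow> ('a \<Rightarrow> 'a) \<Rightarrow> bool" where
  "isometric_bij d A B f \<longleftrightarrow> bij_betw f A B \<and> (\<forall>x\<in>A. \<forall>y\<in>A. d (f x) (f y) = d x y)"

definition isometry_of :: "('a \<Rightarrow> 'a \<Rightarrow> real) \<Rightarrow> 'a set \<Rightarrow> ('a \<Rightarrow> 'a) \<Rightarrow> bool" where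
  "isometry_of d X g \<longleftrightarrow> isometric_bij d X X g"

definition partial_isometry ::
    "('a \<Rightarrow> 'a \<Rightarrow> real) \<Rightarrow> 'a set \<Rightarrow> 'a set \<Rightarrow> 'a set \<Rightarrow> ('a \<Rightarrow> 'a) \<Rightarrow> bool" where
  "partial_isometry d Y A B f \<longleftrightarrow> A \<subseteq> Y \<and> B \<subseteq> Y \<and> isometric_bij d A B f"

definition extends_on :: "'a set \<Rightarrow> ('a \<Rightarrow> 'a) \<Rightarrow> ('a \<Rightarrow> 'a) \<Rightarrow> bool" where
  "extends_on A f g \<longleftrightarrow> (\<forall>x\<in>A. g x = f x)"

definition extendable :: "'a set \<Rightarrow> ('a \<Rightarrow> 'a \<Rightarrow> real) \<Rightarrow> 'a set \<Rightarrow> ('a \<Rightarrow> 'a) \<Rightarrow> bool" where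
  "extendable X d A f \<longleftrightarrow> (\<exists>g. isometry_of d X g \<and> extends_on A f g)"

text \<open>The library's \<^const>\<open>diameter\<close>, for a distance function that is not a type-class instance.\<close>

definition mdiameter :: "('a \<Rightarrow> 'a \<Rightarrow> real) \<Rightarrow> 'a set \<Rightarrow> real" where
  "mdiameter d S = (if S = {} then 0 else SUP (x,y)\<in>S\<times>S. d x y)"

lemma mdiameter_dist: "mdiameter dist S = diameter S"
  by (simp add: mdiameter_def diameter_def)

end

theory Submission
  imports Defs
begin

text \<open>
  Induct on the number of points of \<open>Y\<close>. Let \<open>r\<close> be the largest distance in \<open>Y\<close> and cut \<open>Y\<close>
  along the open balls of radius \<open>r\<close>, which any isometry of the space permutes. If no two points
  of \<open>Y\<close> at distance \<open>r\<close> lie in one orbit, the pieces can be treated independently, and each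
  is smaller than \<open>Y\<close>. Otherwise move all balls of an orbit onto one ball \<open>c\<close> and apply the induction
  hypothesis to the union of the transported pieces in \<open>c\<close>; choosing one transport to identify
  two points of \<open>Y\<close> at distance \<open>r\<close> makes this union smaller than \<open>Y\<close>. Transporting the
  resulting sets back to every ball gives \<open>Z\<close>. A partial isometry induces an orbit-preserving partial
  injection of the balls; complete it to a permutation, extend ball by ball, and glue.
\<close>

section \<open>Completing partial injections of a finite set\<close>

text \<open>A point \<open>b\<close> of \<open>I\<close> outside \<open>D\<close> leaves a value of
  its own fibre free, by counting, so the domain can grow one point at a time until it is all of
  \<open>I\<close>. The fibres will be the classes of balls under isometries.\<close>

lemma extend_fibre_preserving_injection:
  fixes p :: "'b \<Rightarrow> 'b" and \<rho> :: "'b \<Rightarrow> 'c"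
  assumes "finite I" "D \<subseteq> I" "p ` D \<subseteq> I" "inj_on p D" "\<forall>b\<in>D. \<rho> (p b) = \<rho> b"
  shows "\<exists>\<sigma>. bij_betw \<sigma> I I \<and> (\<forall>b\<in>D. \<sigma> b = p b) \<and> (\<forall>b\<in>I. \<rho> (\<sigma> b) = \<rho> b)"
  using assms
proof (induction "card (I - D)" arbitrary: D p)
  case 0
  then have "D = I" by auto
  with 0 have "bij_betw p I I"
    by (metis bij_betw_def endo_inj_surj)
  with 0 \<open>D = I\<close> show ?case by blast
next
  case (Suc n)
  then obtain b where b: "b \<in> I" "b \<notin> D"
    by (metis Diff_eq_empty_iff card.empty nat.distinct(1) subsetI)
  define F where "F = {x \<in> I. \<rho> x = \<rho> b}"
  have fin: "finite F" "finite D"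
    using Suc.prems finite_subset by (auto simp: F_def)
  have "card (p ` (D \<inter> F)) \<le> card (D \<inter> F)"
    using fin by (simp add: card_image_le)
  also have "\<dots> < card F"
    using b fin by (intro psubset_card_mono) (auto simp: F_def)
  finally have "\<not> F \<subseteq> p ` (D \<inter> F)"
    using fin by (meson card_mono finite_Int finite_imageI leD)
  then obtain b' where b': "b' \<in> F" "b' \<notin> p ` (D \<inter> F)" by blast
  have new: "b' \<notin> p ` D"
    using b' Suc.prems by (auto simp: F_def)
  define q where "q = p(b := b')"
  have "card (I - insert b D) = n"
    using Suc.hyps(2) b Suc.prems(1)
    by (simp add: Diff_insert [of I b D] card_Diff_singleton)
  moreover have "inj_on q (insert b D)"
    using Suc.prems(4) b new by (auto simp: q_def inj_on_def)
  moreover have "q ` insert b D \<subseteq> I"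
    using Suc.prems b b' by (auto simp: q_def F_def)
  moreover have "\<forall>x\<in>insert b D. \<rho> (q x) = \<rho> x"
    using Suc.prems b b' by (auto simp: q_def F_def)
  ultimately obtain \<sigma> where "bij_betw \<sigma> I I" "\<forall>x\<in>insert b D. \<sigma> x = q x" "\<forall>x\<in>I. \<rho> (\<sigma> x) = \<rho> x"
    using Suc.hyps(1)[of "insert b D" q] b Suc.prems by auto
  moreover have "\<forall>x\<in>D. q x = p x" using b by (auto simp: q_def)
  ultimately show ?case by auto
qed

section \<open>Isometries of the whole space and their action on balls\<close>

context Metric_space
begin

text \<open>The members are total functions with arbitrary values outside \<open>M\<close>. Inverses
  are therefore formed with \<open>inv_into M\<close>, and cancellation laws hold only at points of
  \<open>M\<close>.\<close>

definition isoms :: "('a \<Rightarrow> 'a) set" where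
  "isoms = {g. isometry_of d M g}"

text \<open>Injectivity comes for free: points with equal images are at distance zero.\<close>

lemma isoms_iff:
  "g \<in> isoms \<longleftrightarrow> (g ` M = M \<and> (\<forall>x\<in>M. \<forall>y\<in>M. d (g x) (g y) = d x y))"
proof -
  have "inj_on g M" if "g ` M = M" "\<forall>x\<in>M. \<forall>y\<in>M. d (g x) (g y) = d x y"
    using that by (metis inj_onI zero)
  then show ?thesis
    by (auto simp: isoms_def isometry_of_def isometric_bij_def bij_betw_def)
qed

lemma isoms_inj: "g \<in> isoms \<Longrightarrow> inj_on g M"
  by (simp add: isoms_def isometry_of_def isometric_bij_def bij_betw_def)

lemma isoms_in: "g \<in> isoms \<Longrightarrow> x \<in> M \<Longrightarrow> g x \<in> M"
  by (auto simp: isoms_iff)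

lemma isoms_dist: "g \<in> isoms \<Longrightarrow> x \<in> M \<Longrightarrow> y \<in> M \<Longrightarrow> d (g x) (g y) = d x y"
  by (auto simp: isoms_iff)

lemma isoms_id: "id \<in> isoms"
  by (simp add: isoms_iff)

lemma isoms_comp: "g \<in> isoms \<Longrightarrow> h \<in> isoms \<Longrightarrow> g \<circ> h \<in> isoms"
  unfolding isoms_iff [of "g \<circ> h"] image_comp [symmetric]
  by (simp add: isoms_in isoms_dist) (simp add: isoms_iff)

lemma isoms_inv_left: "g \<in> isoms \<Longrightarrow> x \<in> M \<Longrightarrow> inv_into M g (g x) = x"
  by (simp add: isoms_inj)

lemma isoms_inv_right: "g \<in> isoms \<Longrightarrow> x \<in> M \<Longrightarrow> g (inv_into M g x) = x"
  by (simp add: isoms_iff f_inv_into_f)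

lemma isoms_inv:
  assumes "g \<in> isoms"
  shows "inv_into M g \<in> isoms"
proof -
  have "inv_into M g x \<in> M" if "x \<in> M" for x
    using assms that by (simp add: isoms_iff inv_into_into)
  moreover have "inv_into M g ` M = M"
    using inv_into_image_cancel[OF isoms_inj[OF assms] subset_refl] assms by (simp add: isoms_iff)
  ultimately show ?thesis
    using isoms_dist[OF assms] isoms_inv_right[OF assms]
    unfolding isoms_iff[of "inv_into M g"] by metis
qed

lemma isoms_image_inv:
  "g \<in> isoms \<Longrightarrow> S \<subseteq> M \<Longrightarrow> g ` S = T \<Longrightarrow> inv_into M g ` T = S"
  by (metis inv_into_image_cancel isoms_inj)

lemma isoms_mball:
  assumes "g \<in> isoms" "x \<in> M"
  shows "g ` mball x r = mball (g x) r"
proof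
  show "g ` mball x r \<subseteq> mball (g x) r"
    using assms by (auto simp: isoms_in isoms_dist)
  show "mball (g x) r \<subseteq> g ` mball x r"
  proof
    fix y assume y: "y \<in> mball (g x) r"
    then have "y \<in> g ` M" using assms(1) by (simp add: isoms_iff)
    then obtain z where "z \<in> M" "y = g z" by blast
    then show "y \<in> g ` mball x r" using y assms by (auto simp: isoms_dist)
  qed
qed

text \<open>A glued map is controlled one ball at a time, which yields pointwise membership
  equivalences; surjectivity of \<open>h\<close> on \<open>M\<close> turns them into an equality of
  sets.\<close>

lemma isoms_image_eq:
  assumes "h \<in> isoms" "Z \<subseteq> M" "\<And>z. z \<in> M \<Longrightarrow> h z \<in> Z \<longleftrightarrow> z \<in> Z"
  shows "h ` Z = Z"
proof
  show "h ` Z \<subseteq> Z" using assms by auto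
  show "Z \<subseteq> h ` Z"
  proof
    fix z assume "z \<in> Z"
    then have "z \<in> h ` M" using assms(1,2) by (auto simp: isoms_iff)
    then obtain w where "w \<in> M" "z = h w" by blast
    then show "z \<in> h ` Z" using assms(3) \<open>z \<in> Z\<close> by blast
  qed
qed

section \<open>Homogeneous hulls\<close>

text \<open>Extendable partial isometries appear as restrictions to \<open>A\<close> of a global
  \<open>g\<close>. The last clause expresses closeness below the diameter without a supremum; its
  alternative \<open>z \<in> Y\<close> admits sets with at most one point. In the induction this
  clause keeps the hull of a subset of a ball inside that ball.\<close>

definition homogeneous_hull :: "'a set \<Rightarrow> 'a set \<Rightarrow> bool" where
  "homogeneous_hull Y Z \<longleftrightarrow> finite Z \<and> Z \<subseteq> M \<and> Y \<subseteq> Z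
    \<and> (\<forall>g A. g \<in> isoms \<and> A \<subseteq> Y \<and> g ` A \<subseteq> Y \<longrightarrow> (\<exists>h\<in>isoms. h ` Z = Z \<and> (\<forall>x\<in>A. h x = g x)))
    \<and> (\<forall>z\<in>Z. z \<in> Y \<or> (\<exists>y\<in>Y. \<exists>y1\<in>Y. \<exists>y2\<in>Y. d z y < d y1 y2))"

lemma homogeneous_hullD:
  assumes "homogeneous_hull Y Z"
  shows "finite Z" "Z \<subseteq> M" "Y \<subseteq> Z"
    and "\<And>g A. g \<in> isoms \<Longrightarrow> A \<subseteq> Y \<Longrightarrow> g ` A \<subseteq> Y \<Longrightarrow>
      \<exists>h\<in>isoms. h ` Z = Z \<and> (\<forall>x\<in>A. h x = g x)"
    and "\<And>z. z \<in> Z \<Longrightarrow> z \<in> Y \<or> (\<exists>y\<in>Y. \<exists>y1\<in>Y. \<exists>y2\<in>Y. d z y < d y1 y2)"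
  using assms unfolding homogeneous_hull_def by metis+

end

section \<open>Ultrametric balls and gluing of isometries\<close>

context Ultrametric_space
begin

text \<open>The strong triangle inequality makes closeness to \<open>x\<close> and closeness to
  \<open>y\<close> the same condition. Hence the open balls of a fixed positive radius partition
  \<open>M\<close>, and each is \<open>mball z r\<close> for any of its points
  \<open>z\<close>.\<close>

lemma mball_eq: "y \<in> mball x r \<Longrightarrow> mball y r = mball x r"
proof -
  assume y: "y \<in> mball x r"
  have "d y z < r \<longleftrightarrow> d x z < r" if "z \<in> M" for z
    using y that ultrametric[of x y z] ultrametric[of y x z] commute[of x y] by auto
  then show ?thesis using y by auto
qed

lemma mball_eq_iff: "0 < r \<Longrightarrow> x \<in> M \<Longrightarrow> y \<in> M \<Longrightarrow> mball x r = mball y r \<longleftrightarrow> d x y < r"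
  by (metis centre_in_mball_iff commute in_mball mball_eq)

text \<open>Within one ball the map is a single isometry. Points in two different balls of
  \<open>I\<close> are at distance exactly \<open>r\<close>, before and after, since
  \<open>\<sigma>\<close> keeps balls distinct. Distances to points outside the balls of
  \<open>I\<close> survive because no point is moved by more than \<open>r\<close>.\<close>

lemma glue_isoms:
  assumes r: "0 < r"
    and I: "\<And>b. b \<in> I \<Longrightarrow> \<exists>x\<in>M. b = mball x r"
    and diam: "\<And>b b' x y. b \<in> I \<Longrightarrow> b' \<in> I \<Longrightarrow> x \<in> b \<Longrightarrow> y \<in> b' \<Longrightarrow> d x y \<le> r"
    and \<sigma>: "bij_betw \<sigma> I I"
    and u: "\<And>b. b \<in> I \<Longrightarrow> u b \<in> isoms \<and> u b ` b = \<sigma> b"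
  shows "(\<lambda>z. if mball z r \<in> I then u (mball z r) z else z) \<in> isoms"
proof -
  define h where "h = (\<lambda>z. if mball z r \<in> I then u (mball z r) z else z)"
  have self: "z \<in> mball z r" if "z \<in> M" for z
    using that r by simp
  have img: "h z \<in> M \<and> mball (h z) r = \<sigma> (mball z r)" if "z \<in> M" "mball z r \<in> I" for z
    using that u isoms_mball[of "u (mball z r)" z r] by (simp add: isoms_in h_def)
  have in_I: "mball (h z) r \<in> I" if "z \<in> M" "mball z r \<in> I" for z
    using img[OF that] \<sigma> that by (metis bij_betwE)
  have mix: "d (h z) w = d z w" if zw: "z \<in> M" "w \<in> M" "mball z r \<in> I" "mball w r \<notin> I" for z w
  proof -
    let ?y = "h z"
    have y: "?y \<in> M" "mball ?y r \<in> I" using img in_I zw by auto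
    have "d z ?y \<le> r" using diam[OF zw(3) y(2)] self zw y by blast
    moreover have "\<not> d z w < r" "\<not> d ?y w < r"
      using mball_eq_iff[OF r] zw y by metis+
    \<comment> \<open>Both distances to \<open>w\<close> are at least \<open>r\<close>, while
      \<open>d z ?y\<close> is at most \<open>r\<close>, so each of the two distances bounds the
      other.\<close>
    moreover have "d z w \<le> max (d z ?y) (d ?y w)" "d ?y w \<le> max (d z ?y) (d z w)"
      using ultrametric[OF \<open>z \<in> M\<close> \<open>?y \<in> M\<close> \<open>w \<in> M\<close>] ultrametric[OF \<open>?y \<in> M\<close> \<open>z \<in> M\<close> \<open>w \<in> M\<close>]
        commute[of z ?y] by auto
    ultimately show ?thesis by linarith
  qed
  have dist: "d (h z) (h w) = d z w" if zw: "z \<in> M" "w \<in> M" for z w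
  proof (cases "mball z r \<in> I \<and> mball w r \<in> I")
    case True
    show ?thesis
    proof (cases "mball z r = mball w r")
      case True
      with \<open>mball z r \<in> I \<and> mball w r \<in> I\<close> show ?thesis using u zw by (simp add: isoms_dist h_def)
    next
      case False
      with True \<sigma> have "\<sigma> (mball z r) \<noteq> \<sigma> (mball w r)"
        by (metis bij_betw_imp_inj_on inj_on_contraD)
      then have "mball (h z) r \<noteq> mball (h w) r" using img zw True by simp
      moreover have hM: "h z \<in> M" "h w \<in> M" using img zw True by blast+
      ultimately have "\<not> d (h z) (h w) < r" "\<not> d z w < r"
        using mball_eq_iff[OF r] zw False by blast+
      moreover have "d (h z) (h w) \<le> r"
        by (rule diam[of "mball (h z) r" "mball (h w) r"]) (use in_I zw True self hM in blast)+
      moreover have "d z w \<le> r"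
        by (rule diam[of "mball z r" "mball w r"]) (use zw True self in blast)+
      ultimately show ?thesis by linarith
    qed
  next
    case False
    then show ?thesis using mix[of z w] mix[of w z] zw commute[of z] commute[of "h z"] by (auto simp: h_def)
  qed
  have "w \<in> h ` M" if "w \<in> M" for w
  proof (cases "mball w r \<in> I")
    case True
    then obtain b where b: "b \<in> I" "\<sigma> b = mball w r"
      using \<sigma> by (metis bij_betw_def imageE)
    then have "w \<in> u b ` b" using u[of b] self[OF \<open>w \<in> M\<close>] by blast
    then obtain z where z: "z \<in> b" "u b z = w" by blast
    obtain x where "b = mball x r" using I[OF b(1)] by blast
    then have "mball z r = b" "z \<in> M" using z(1) mball_eq[of z x r] by auto
    then show ?thesis using b z by (auto simp: h_def intro!: image_eqI[of _ _ z])
  next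
    case False
    then show ?thesis using that by (auto simp: h_def intro!: image_eqI[of _ _ w])
  qed
  moreover have "h z \<in> M" if "z \<in> M" for z using img[OF that] that by (auto simp: h_def)
  ultimately have "h ` M = M" by blast
  then have "h \<in> isoms" using dist by (simp add: isoms_iff)
  then show ?thesis by (simp add: h_def)
qed

section \<open>The induction step: hulls assembled from the balls\<close>

text \<open>Here \<open>s b\<close> transports the ball \<open>b\<close> onto the ball \<open>\<rho> b\<close> representing its class.\<close>

lemma homogeneous_hull_step:
  fixes \<rho> :: "'a set \<Rightarrow> 'a set" and s :: "'a set \<Rightarrow> 'a \<Rightarrow> 'a" and Y :: "'a set" and r :: real
  defines "Q \<equiv> \<lambda>c. (\<lambda>x. s (mball x r) x) ` {x \<in> Y. \<rho> (mball x r) = c}"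
  assumes Y: "finite Y" "Y \<subseteq> M"
    and r: "0 < r" "\<And>x y. x \<in> Y \<Longrightarrow> y \<in> Y \<Longrightarrow> d x y \<le> r" "\<exists>y1\<in>Y. \<exists>y2\<in>Y. d y1 y2 = r"
    and s: "\<And>x. x \<in> Y \<Longrightarrow> s (mball x r) \<in> isoms \<and> s (mball x r) ` mball x r = \<rho> (mball x r)"
    and \<rho>: "\<And>g x. g \<in> isoms \<Longrightarrow> x \<in> Y \<Longrightarrow> g x \<in> Y \<Longrightarrow> \<rho> (mball (g x) r) = \<rho> (mball x r)"
    and hull: "\<And>y. y \<in> Y \<Longrightarrow> \<exists>W. homogeneous_hull (Q (\<rho> (mball y r))) W"
  shows "\<exists>Z. homogeneous_hull Y Z"
proof -
  define I where "I = (\<lambda>x. mball x r) ` Y"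
  have self: "z \<in> mball z r" if "z \<in> M" for z
    using that r by simp
  have key: "mball z r = b" "z \<in> M" if "b \<in> I" "z \<in> b" for b z
    using that mball_eq by (auto simp: I_def simp del: in_mball) simp
  have finI: "finite I" using Y by (simp add: I_def)
  have sI: "s b \<in> isoms" "s b ` b = \<rho> b" if "b \<in> I" for b
    using that s by (auto simp: I_def)
  have "\<forall>c\<in>\<rho> ` I. \<exists>W. homogeneous_hull (Q c) W"
    using hull by (simp add: I_def)
  \<comment> \<open>One hull is chosen per representative \<open>\<rho> b\<close> rather than per
    ball, so that all balls of a class carry copies of the same set.\<close>
  then obtain W where W: "\<And>b. b \<in> I \<Longrightarrow> homogeneous_hull (Q (\<rho> b)) (W (\<rho> b))"
    by (metis image_eqI)
  have Q_mem: "s b x \<in> Q (\<rho> b')" if "b \<in> I" "x \<in> Y" "x \<in> b" "\<rho> b = \<rho> b'" for b b' x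
    using that key[OF that(1,3)] by (auto simp: Q_def)
  have Q_sub: "Q (\<rho> b) \<subseteq> \<rho> b" for b
  proof
    fix q assume "q \<in> Q (\<rho> b)"
    then obtain x where "x \<in> Y" "\<rho> (mball x r) = \<rho> b" "q = s (mball x r) x"
      by (auto simp: Q_def)
    moreover have "x \<in> mball x r" using self Y calculation by blast
    ultimately show "q \<in> \<rho> b" using s[of x] by blast
  qed
  have \<rho>_ball: "\<exists>x\<in>M. \<rho> b = mball x r" if b: "b \<in> I" for b
  proof -
    obtain x where x: "x \<in> Y" "b = mball x r" using b by (auto simp: I_def)
    then have "x \<in> M" "s b \<in> isoms" "s b ` b = \<rho> b" using s Y by auto
    then show ?thesis using isoms_mball[of "s b" x r] isoms_in[of "s b" x] x by auto
  qed
  \<comment> \<open>Distances inside \<open>Q (\<rho> b)\<close> are below \<open>r\<close>, so the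
    closeness clause puts every new point of the hull within \<open>r\<close> of a point of the
    ball.\<close>
  have W_sub: "W (\<rho> b) \<subseteq> \<rho> b" if "b \<in> I" for b
  proof
    fix w assume w: "w \<in> W (\<rho> b)"
    obtain x where x: "x \<in> M" "\<rho> b = mball x r" using \<rho>_ball \<open>b \<in> I\<close> by blast
    have near: "v \<in> M \<and> mball v r = mball x r" if "v \<in> Q (\<rho> b)" for v
    proof -
      have "v \<in> mball x r" using that Q_sub[of b] x by blast
      then show ?thesis using mball_eq[of v x r] by simp
    qed
    have wM: "w \<in> M" using homogeneous_hullD(2)[OF W[OF \<open>b \<in> I\<close>]] w by blast
    consider "w \<in> Q (\<rho> b)" | y y1 y2 where "y \<in> Q (\<rho> b)" "y1 \<in> Q (\<rho> b)" "y2 \<in> Q (\<rho> b)" "d w y < d y1 y2"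
      using homogeneous_hullD(5)[OF W[OF \<open>b \<in> I\<close>] w] by blast
    then show "w \<in> \<rho> b"
    proof cases
      case 1 then show ?thesis using Q_sub by blast
    next
      case 2
      have "d y1 y2 < r"
        using mball_eq_iff[OF r(1), of y1 y2] near[OF 2(2)] near[OF 2(3)] by simp
      then have "mball w r = mball y r"
        using 2(4) mball_eq_iff[OF r(1), of w y] wM near[OF 2(1)] by linarith
      then show ?thesis using near[OF 2(1)] x self[OF wM] by simp
    qed
  qed
  define Z where "Z = (\<Union>b\<in>I. {z \<in> b. s b z \<in> W (\<rho> b)})"
  have Z_iff: "z \<in> Z \<longleftrightarrow> s b z \<in> W (\<rho> b)" if "b \<in> I" "z \<in> b" for b z
    using that key unfolding Z_def by blast
  have ZM: "Z \<subseteq> M" using key(2) unfolding Z_def by blast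
  have finZ: "finite Z"
    unfolding Z_def
  proof (intro finite_UN_I finI)
    fix b assume b: "b \<in> I"
    have "finite (W (\<rho> b))" using homogeneous_hullD(1)[OF W[OF b]] .
    moreover have "inj_on (s b) b"
      using isoms_inj[OF sI(1)[OF b]] key(2)[OF b] by (meson inj_on_subset subsetI)
    ultimately have "finite (s b -` W (\<rho> b) \<inter> b)" by (rule finite_vimage_IntI)
    then show "finite {z \<in> b. s b z \<in> W (\<rho> b)}" by (simp add: vimage_def Int_def conj_commute)
  qed
  have YZ: "Y \<subseteq> Z"
  proof
    fix x assume x: "x \<in> Y"
    then have b: "mball x r \<in> I" "x \<in> mball x r" using Y r by (auto simp: I_def)
    then have "s (mball x r) x \<in> W (\<rho> (mball x r))"
      using homogeneous_hullD(3)[OF W[OF b(1)]] Q_mem[OF b(1) x b(2)] by blast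
    then show "x \<in> Z" using Z_iff b by blast
  qed
  \<comment> \<open>Every point of \<open>Z\<close> shares a ball with a point of \<open>Y\<close>,
    and \<open>r\<close> is itself a distance in \<open>Y\<close>.\<close>
  have near: "\<exists>y\<in>Y. \<exists>y1\<in>Y. \<exists>y2\<in>Y. d z y < d y1 y2" if z: "z \<in> Z" for z
  proof -
    obtain x where "x \<in> Y" "z \<in> mball x r" using z by (auto simp: Z_def I_def)
    then show ?thesis using r(3) by (metis commute in_mball)
  qed
  have ext: "\<exists>h\<in>isoms. h ` Z = Z \<and> (\<forall>x\<in>A. h x = g x)"
    if g: "g \<in> isoms" and A: "A \<subseteq> Y" "g ` A \<subseteq> Y" for g A
  proof -
    \<comment> \<open>These are the balls that meet \<open>A\<close>; on them the permutation of
      balls is dictated by \<open>g\<close>.\<close>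
    define D where "D = (\<lambda>x. mball x r) ` A"
    have AM: "A \<subseteq> M" using A Y by blast
    have gball: "g ` mball x r = mball (g x) r" if "x \<in> A" for x
      using isoms_mball[OF g] that AM by blast
    have "D \<subseteq> I" using A by (auto simp: D_def I_def)
    moreover have "(`) g ` D \<subseteq> I"
    proof
      fix c assume "c \<in> (`) g ` D"
      then obtain x where "x \<in> A" "c = mball (g x) r" using gball unfolding D_def by blast
      then show "c \<in> I" using A unfolding I_def by blast
    qed
    moreover have "inj_on ((`) g) D"
    proof (rule inj_onI)
      fix b b' assume bb: "b \<in> D" "b' \<in> D" "g ` b = g ` b'"
      then have "b \<subseteq> M" "b' \<subseteq> M" by (auto simp: D_def)
      then show "b = b'" using bb inj_on_image_eq_iff[OF isoms_inj[OF g]] by blast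
    qed
    moreover have "\<forall>b\<in>D. \<rho> (g ` b) = \<rho> b"
    proof
      fix b assume b: "b \<in> D"
      obtain x where x: "x \<in> A" "b = mball x r" using b unfolding D_def by blast
      then have "x \<in> Y" "g x \<in> Y" using A by auto
      then show "\<rho> (g ` b) = \<rho> b" using \<rho>[OF g] gball x by simp
    qed
    ultimately have "\<exists>\<sigma>. bij_betw \<sigma> I I \<and> (\<forall>b\<in>D. \<sigma> b = g ` b) \<and> (\<forall>b\<in>I. \<rho> (\<sigma> b) = \<rho> b)"
      by (rule extend_fibre_preserving_injection[OF finI])
    then obtain \<sigma> where \<sigma>: "bij_betw \<sigma> I I" "\<forall>b\<in>D. \<sigma> b = g ` b" "\<forall>b\<in>I. \<rho> (\<sigma> b) = \<rho> b"
      by blast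
    \<comment> \<open>Each ball gets its own isometry onto \<open>\<sigma> b\<close>, respecting
      \<open>Z\<close> and agreeing with \<open>g\<close> on \<open>A\<close>. Balls that miss
      \<open>A\<close> follow the same argument with an empty partial map.\<close>
    have "\<forall>b\<in>I. \<exists>u. u \<in> isoms \<and> u ` b = \<sigma> b \<and> (\<forall>z\<in>b. u z \<in> Z \<longleftrightarrow> z \<in> Z) \<and> (\<forall>x\<in>A \<inter> b. u x = g x)"
    proof
      fix b assume b: "b \<in> I"
      have b': "\<sigma> b \<in> I" "\<rho> (\<sigma> b) = \<rho> b" using \<sigma>(3) b bij_betwE[OF \<sigma>(1)] by auto
      let ?s = "s b" and ?t = "s (\<sigma> b)"
      note s1 = sI[OF b] and t1 = sI[OF b'(1)]
      have bM: "b \<subseteq> M" "\<sigma> b \<subseteq> M" using key(2)[OF b] key(2)[OF b'(1)] by auto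
      \<comment> \<open>Conjugating \<open>g\<close> by the transports makes it act inside the
        representative ball, where the hull property of \<open>W (\<rho> b)\<close> applies.\<close>
      define k where "k = ?t \<circ> g \<circ> inv_into M ?s"
      have k: "k \<in> isoms" using s1 t1 g by (simp add: k_def isoms_comp isoms_inv)
      have kx: "k (?s x) = ?t (g x)" "?s x \<in> Q (\<rho> b)" "?t (g x) \<in> Q (\<rho> b)" if x: "x \<in> A \<inter> b" for x
      proof -
        show "k (?s x) = ?t (g x)" using x bM s1 isoms_inv_left by (auto simp: k_def)
        show "?s x \<in> Q (\<rho> b)" using Q_mem x A b by blast
        have "b \<in> D" using x key(1)[OF b] by (auto simp: D_def simp del: in_mball)
        then have "g x \<in> \<sigma> b" using x \<sigma> by blast
        then show "?t (g x) \<in> Q (\<rho> b)" using Q_mem[OF b'(1)] b'(2) x A by blast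
      qed
      have "?s ` (A \<inter> b) \<subseteq> Q (\<rho> b)" "k ` ?s ` (A \<inter> b) \<subseteq> Q (\<rho> b)"
        using kx by auto
      from homogeneous_hullD(4)[OF W[OF b] k this] obtain h where h: "h \<in> isoms" "h ` W (\<rho> b) = W (\<rho> b)" "\<forall>x\<in>?s ` (A \<inter> b). h x = k x"
        by blast
      have WM: "W (\<rho> b) \<subseteq> M" "Q (\<rho> b) \<subseteq> W (\<rho> b)" using homogeneous_hullD(2,3)[OF W[OF b]] .
      have h_iff: "h v \<in> W (\<rho> b) \<longleftrightarrow> v \<in> W (\<rho> b)" if "v \<in> M" for v
        using h(2) WM(1) that isoms_inj[OF h(1)] by (metis inj_on_image_mem_iff)
      \<comment> \<open>A ball of \<open>I\<close> contains a point of \<open>Y\<close>, so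
        \<open>W (\<rho> b)\<close> is nonempty. As \<open>h\<close> preserves this set, it sends
        some point of the ball into the ball, hence the ball onto itself.\<close>
      have h_\<rho>: "h ` \<rho> b = \<rho> b"
      proof -
        obtain x where x: "x \<in> M" "\<rho> b = mball x r" using \<rho>_ball b by blast
        obtain y where "y \<in> Y" "y \<in> b" using b Y r by (auto simp: I_def)
        then have w: "?s y \<in> W (\<rho> b)" using Q_mem[OF b, of y b] WM(2) by blast
        then have "h (?s y) \<in> W (\<rho> b)" using h(2) by blast
        with w have "?s y \<in> mball x r" "h (?s y) \<in> mball x r" using W_sub[OF b] x(2) by auto
        then have "mball (?s y) r = \<rho> b" "mball (h (?s y)) r = \<rho> b"
          unfolding x(2) by (auto intro!: mball_eq simp del: in_mball)
        then show ?thesis using isoms_mball[OF h(1), of "?s y" r] w WM(1) by auto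
      qed
      define u where "u = inv_into M ?t \<circ> h \<circ> ?s"
      have "u \<in> isoms" using s1 t1 h by (simp add: u_def isoms_comp isoms_inv)
      moreover have ub: "u ` b = \<sigma> b"
        unfolding u_def image_comp [symmetric]
        using s1 h_\<rho> isoms_image_inv[OF t1(1) bM(2) t1(2)] b'(2) by simp
      moreover have "u z \<in> Z \<longleftrightarrow> z \<in> Z" if z: "z \<in> b" for z
      proof -
        have sz: "?s z \<in> M" "h (?s z) \<in> M" using z bM(1) isoms_in[OF s1(1)] isoms_in[OF h(1)] by auto
        have "u z \<in> \<sigma> b" using ub z by blast
        then have "u z \<in> Z \<longleftrightarrow> ?t (u z) \<in> W (\<rho> b)" using Z_iff[OF b'(1)] b'(2) by simp
        also have "?t (u z) = h (?s z)" using isoms_inv_right[OF t1(1)] sz by (simp add: u_def)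
        finally show ?thesis using h_iff sz Z_iff[OF b z] by simp
      qed
      moreover have "u x = g x" if x: "x \<in> A \<inter> b" for x
      proof -
        have "h (?s x) = ?t (g x)" using h(3) kx x by auto
        then show ?thesis using isoms_inv_left[OF t1(1)] isoms_in[OF g] x bM by (auto simp: u_def)
      qed
      ultimately show "\<exists>u. u \<in> isoms \<and> u ` b = \<sigma> b \<and> (\<forall>z\<in>b. u z \<in> Z \<longleftrightarrow> z \<in> Z) \<and> (\<forall>x\<in>A \<inter> b. u x = g x)"
        by (intro exI[of _ u] conjI ballI)
    qed
    from bchoice[OF this] obtain u where
      "\<forall>b\<in>I. u b \<in> isoms \<and> u b ` b = \<sigma> b \<and> (\<forall>z\<in>b. u b z \<in> Z \<longleftrightarrow> z \<in> Z) \<and> (\<forall>x\<in>A \<inter> b. u b x = g x)" ..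
    then have u: "\<And>b. b \<in> I \<Longrightarrow> u b \<in> isoms \<and> u b ` b = \<sigma> b"
      "\<And>b z. b \<in> I \<Longrightarrow> z \<in> b \<Longrightarrow> u b z \<in> Z \<longleftrightarrow> z \<in> Z"
      "\<And>b x. b \<in> I \<Longrightarrow> x \<in> A \<inter> b \<Longrightarrow> u b x = g x"
      by simp_all
    define h where "h = (\<lambda>z. if mball z r \<in> I then u (mball z r) z else z)"
    have diam: "d x y \<le> r" if b: "b \<in> I" "b' \<in> I" and xy: "x \<in> b" "y \<in> b'" for b b' x y
    proof -
      obtain v w where vw: "v \<in> Y" "b = mball v r" "w \<in> Y" "b' = mball w r"
        using b by (auto simp: I_def)
      have m: "x \<in> M" "v \<in> M" "w \<in> M" "y \<in> M" "d v x < r" "d w y < r" "d v w \<le> r"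
        using vw xy Y r by auto
      then show ?thesis
        using ultrametric[of x v y] ultrametric[of v w y] commute[of v x] by linarith
    qed
    have "\<exists>x\<in>M. b = mball x r" if "b \<in> I" for b
      using that Y by (auto simp: I_def)
    then have hi: "h \<in> isoms"
      unfolding h_def by (rule glue_isoms[OF r(1) _ diam \<sigma>(1) u(1)])
    moreover have "h ` Z = Z"
    proof (rule isoms_image_eq[OF hi ZM])
      show "h z \<in> Z \<longleftrightarrow> z \<in> Z" if "z \<in> M" for z
        using that u(2) self by (simp add: h_def)
    qed
    moreover have "h x = g x" if "x \<in> A" for x
    proof -
      have "mball x r \<in> I" "x \<in> A \<inter> mball x r" using that A AM self by (auto simp: I_def r)
      then show ?thesis using u(3)[of "mball x r" x] by (simp add: h_def del: in_mball)
    qed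
    ultimately show ?thesis by (intro bexI[of _ h] conjI ballI)
  qed
  show ?thesis
    unfolding homogeneous_hull_def
    by (intro exI[of _ Z] conjI allI impI ballI finZ ZM YZ ext disjI2 near) auto
qed

section \<open>Existence of hulls by induction on cardinality\<close>

lemma ex_homogeneous_hull:
  assumes "finite Y" "Y \<subseteq> M"
  shows "\<exists>Z. homogeneous_hull Y Z"
  using assms
proof (induction "card Y" arbitrary: Y rule: less_induct)
  case less
  show ?case
  proof (cases "\<exists>y1\<in>Y. \<exists>y2\<in>Y. y1 \<noteq> y2")
    case False
    then have all_eq: "x = y" if "x \<in> Y" "y \<in> Y" for x y using that by blast
    \<comment> \<open>With at most one point, \<open>Y\<close> is its own hull: \<open>A\<close> is
      empty, or \<open>g\<close> fixes the only point.\<close>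
    have ext: "\<exists>h\<in>isoms. h ` Y = Y \<and> (\<forall>x\<in>A. h x = g x)"
      if g: "g \<in> isoms" and A: "A \<subseteq> Y" "g ` A \<subseteq> Y" for g A
    proof (cases "A = {}")
      case True
      then show ?thesis using isoms_id by (intro bexI[of _ id]) auto
    next
      case False
      then obtain a where a: "a \<in> A" by blast
      then have "Y = {a}" "g a = a" using A all_eq[of _ a] by auto
      then show ?thesis using g A(1) by (intro bexI[of _ g]) auto
    qed
    show ?thesis
      unfolding homogeneous_hull_def
      by (intro exI[of _ Y] conjI allI impI ballI less.prems subset_refl disjI1 ext) auto
  next
    case True
    define r where "r = Max ((\<lambda>(x, y). d x y) ` (Y \<times> Y))"
    have fin: "finite ((\<lambda>(x, y). d x y) ` (Y \<times> Y))" "(\<lambda>(x, y). d x y) ` (Y \<times> Y) \<noteq> {}"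
      using less.prems True by auto
    have le: "d x y \<le> r" if "x \<in> Y" "y \<in> Y" for x y
      unfolding r_def using that fin by (intro Max_ge) auto
    have att: "\<exists>y1\<in>Y. \<exists>y2\<in>Y. d y1 y2 = r"
      using Max_in[OF fin] unfolding r_def[symmetric] by auto
    have r: "0 < r"
      using True le less.prems(2) by (metis in_mono mdist_pos_less not_le order.strict_trans2 commute)
    let ?K = "\<lambda>x. mball x r"
    have smaller: "\<exists>W. homogeneous_hull S W" if "card S < card Y" "finite S" "S \<subseteq> M" for S
      using less.hyps that by blast
    show ?thesis
    proof (cases "\<exists>a\<in>Y. \<exists>g\<in>isoms. g a \<in> Y \<and> d a (g a) = r")
      case False
      \<comment> \<open>No isometry moves a point of \<open>Y\<close> to a point of \<open>Y\<close>
        in another ball, so every ball may represent itself with the identity as transport.\<close>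
      have same: "?K (g x) = ?K x" if "g \<in> isoms" "x \<in> Y" "g x \<in> Y" for g x
      proof -
        have "d x (g x) < r" using False le that by (metis order_le_less)
        then show ?thesis using mball_eq_iff[OF r] that less.prems by blast
      qed
      have "\<exists>W. homogeneous_hull ((\<lambda>x. id x) ` {x \<in> Y. ?K x = ?K y}) W" if "y \<in> Y" for y
      proof (rule smaller)
        obtain y1 y2 where y12: "y1 \<in> Y" "y2 \<in> Y" "d y1 y2 = r" using att by blast
        then have "?K y1 \<noteq> ?K y2" using mball_eq_iff[OF r] less.prems by fastforce
        then have "{x \<in> Y. ?K x = ?K y} \<noteq> Y" using y12 by blast
        then show "card ((\<lambda>x. id x) ` {x \<in> Y. ?K x = ?K y}) < card Y"
          using less.prems by (simp add: psubset_card_mono psubset_eq)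
      qed (use less.prems in auto)
      then show ?thesis
        using homogeneous_hull_step[OF less.prems r le att, of "\<lambda>_. id" "\<lambda>b. b"] isoms_id same by simp
    next
      case True
      then obtain a g0 where a: "a \<in> Y" "g0 \<in> isoms" "g0 a \<in> Y" "d a (g0 a) = r" by blast
      define E where "E = (\<lambda>b b'. \<exists>g\<in>isoms. g ` b = b')"
      have E_refl: "E b b" for b
        unfolding E_def using isoms_id by (intro bexI[of _ id]) auto
      have E_trans: "E b b''" if "E b b'" "E b' b''" for b b' b''
        using that isoms_comp unfolding E_def by (metis image_comp)
      have E_sym: "E b' b" if "E b b'" "b \<subseteq> M" for b b'
        using that isoms_inv isoms_image_inv unfolding E_def by metis
      \<comment> \<open>The class of \<open>?K a\<close> must be represented by \<open>?K a\<close> itself, so that \<open>a\<close> and \<open>g0 a\<close> are identified.\<close>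
      define \<rho> where "\<rho> = (\<lambda>b. if E b (?K a) then ?K a else SOME b'. E b b')"
      have E_\<rho>: "E b (\<rho> b)" for b
        using E_refl by (auto simp: \<rho>_def intro: someI)
      have \<rho>_cong: "\<rho> b' = \<rho> b" if "E b b'" "b \<subseteq> M" for b b'
      proof -
        \<comment> \<open>Equality as predicates is what forces \<open>SOME\<close> to pick the same
          representative.\<close>
        have "E b = E b'" using that E_trans E_sym by blast
        then show ?thesis by (simp add: \<rho>_def)
      qed
      \<comment> \<open>The first two cases send both \<open>a\<close> and \<open>g0 a\<close> to
        \<open>a\<close>; elsewhere any transport will do.\<close>
      define s where "s = (\<lambda>b. if b = ?K a then id else if b = ?K (g0 a) then inv_into M g0
        else SOME g. g \<in> isoms \<and> g ` b = \<rho> b)"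
      have aM: "a \<in> M" "g0 a \<in> M" using a less.prems by auto
      have ne: "?K a \<noteq> ?K (g0 a)" using mball_eq_iff[OF r] a aM by fastforce
      have inv0: "inv_into M g0 ` ?K (g0 a) = ?K a"
        using a aM isoms_image_inv isoms_mball mball_subset_mspace by metis
      have \<rho>a: "\<rho> (?K a) = ?K a" using E_refl by (simp add: \<rho>_def)
      have \<rho>g: "\<rho> (?K (g0 a)) = ?K a"
        using inv0 isoms_inv a by (auto simp: \<rho>_def E_def)
      have s: "s b \<in> isoms \<and> s b ` b = \<rho> b" for b
      proof -
        have "\<exists>g. g \<in> isoms \<and> g ` b = \<rho> b" using E_\<rho>[of b] by (auto simp: E_def)
        then have "(SOME g. g \<in> isoms \<and> g ` b = \<rho> b) \<in> isoms \<and> (SOME g. g \<in> isoms \<and> g ` b = \<rho> b) ` b = \<rho> b"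
          by (rule someI_ex)
        then show ?thesis
          using isoms_id isoms_inv a inv0 \<rho>a \<rho>g by (simp add: s_def)
      qed
      have \<rho>_inv: "\<rho> (?K (g x)) = \<rho> (?K x)" if g: "g \<in> isoms" and x: "x \<in> Y" for g x
      proof (rule \<rho>_cong)
        show "E (?K x) (?K (g x))"
          unfolding E_def using g x less.prems by (intro bexI[of _ g] isoms_mball) auto
      qed (rule mball_subset_mspace)
      have "\<exists>W. homogeneous_hull ((\<lambda>x. s (?K x) x) ` {x \<in> Y. \<rho> (?K x) = \<rho> (?K y)}) W" for y
      proof (rule smaller)
        let ?S = "{x \<in> Y. \<rho> (?K x) = \<rho> (?K y)}" and ?f = "\<lambda>x. s (?K x) x"
        have finS: "finite ?S" using less.prems by simp
        \<comment> \<open>In the class of \<open>?K a\<close> the transported set loses a point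
          because \<open>a\<close> and \<open>g0 a\<close> collide; in any other class
          \<open>a\<close> is absent.\<close>
        show "card (?f ` ?S) < card Y"
        proof (cases "\<rho> (?K y) = ?K a")
          case True
          have "?f a = ?f (g0 a)" using ne a aM by (simp add: s_def isoms_inv_left)
          moreover have "a \<in> ?S" "g0 a \<in> ?S" using a \<rho>a \<rho>g True by auto
          moreover have "a \<noteq> g0 a" using ne by metis
          ultimately have "\<not> inj_on ?f ?S" by (meson inj_onD)
          then have "card (?f ` ?S) < card ?S"
            using finS card_image_le eq_card_imp_inj_on le_neq_implies_less by blast
          also have "\<dots> \<le> card Y" using less.prems by (intro card_mono) auto
          finally show ?thesis .
        next
          case False
          then have "a \<notin> ?S" using \<rho>a by auto
          then have "card ?S < card Y" using a less.prems by (intro psubset_card_mono) auto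
          then show ?thesis using card_image_le[OF finS, of ?f] by linarith
        qed
        show "finite (?f ` ?S)" using finS by simp
        show "?f ` ?S \<subseteq> M" using s isoms_in less.prems by auto
      qed
      then show ?thesis
        by (intro homogeneous_hull_step[OF less.prems r le att, where s = s and \<rho> = \<rho>] s \<rho>_inv)
    qed
  qed
qed

end

section \<open>Passage to partial isometries and the diameter\<close>

lemma dist_le_mdiameter:
  assumes "finite Y" "x \<in> Y" "y \<in> Y"
  shows "d x y \<le> mdiameter d Y"
proof -
  have "(case (x, y) of (x, y) \<Rightarrow> d x y) \<le> (SUP (x,y)\<in>Y\<times>Y. d x y)"
    using assms by (intro cSUP_upper bdd_above_finite) auto
  then show ?thesis using assms by (auto simp: mdiameter_def)
qed

theorem lemma4p2:
  fixes X :: "'a set" and d :: "'a \<Rightarrow> 'a \<Rightarrow> real" and Y :: "'a set"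
  assumes "Ultrametric_space X d"
    and "finite Y" and "Y \<subseteq> X"
  shows "\<exists>Z. finite Z \<and> Z \<subseteq> X \<and> Y \<subseteq> Z
    \<and> (\<forall>A B f. partial_isometry d Y A B f \<and> extendable X d A f
          \<longrightarrow> (\<exists>h. isometry_of d Z h \<and> extendable X d Z h \<and> extends_on A f h))
    \<and> (card Y > 1 \<longrightarrow> (\<forall>z\<in>Z. \<exists>y\<in>Y. d z y < mdiameter d Y))"
proof -
  interpret Ultrametric_space X d by fact
  obtain Z where hull: "homogeneous_hull Y Z"
    using ex_homogeneous_hull[OF assms(2,3)] by blast
  note Z = homogeneous_hullD(1-3)[OF hull]
  have ext: "\<exists>h. isometry_of d Z h \<and> extendable X d Z h \<and> extends_on A f h"
    if f: "partial_isometry d Y A B f" "extendable X d A f" for A B f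
  proof -
    \<comment> \<open>The map \<open>f\<close> matters only on \<open>A\<close>, where a global
      isometry agrees with it; this is the form the hull property expects.\<close>
    obtain g where g: "g \<in> isoms" "\<forall>x\<in>A. g x = f x"
      using f(2) by (auto simp: extendable_def extends_on_def isoms_def)
    have AB: "A \<subseteq> Y" "B \<subseteq> Y" "f ` A = B"
      using f(1) by (auto simp: partial_isometry_def isometric_bij_def bij_betw_def)
    then have "g ` A \<subseteq> Y" using g by auto
    then obtain h where h: "h \<in> isoms" "h ` Z = Z" "\<forall>x\<in>A. h x = g x"
      using homogeneous_hullD(4)[OF hull g(1) AB(1)] by blast
    have "isometry_of d Z h"
      unfolding isometry_of_def isometric_bij_def bij_betw_def
      using h(2) isoms_dist[OF h(1)] inj_on_subset[OF isoms_inj[OF h(1)] Z(2)] Z(2) by (simp add: subset_iff)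
    moreover have "extendable X d Z h"
      using h(1) by (auto simp: extendable_def extends_on_def isoms_def)
    ultimately show ?thesis using h g by (auto simp: extends_on_def)
  qed
  have near: "\<exists>y\<in>Y. d z y < mdiameter d Y" if card1: "card Y > 1" and z: "z \<in> Z" for z
  proof -
    obtain y1 y2 where y: "y1 \<in> Y" "y2 \<in> Y" "y1 \<noteq> y2"
      using card1 card_le_Suc0_iff_eq[OF assms(2)] by auto
    then have pos: "0 < mdiameter d Y"
      using dist_le_mdiameter[OF assms(2) y(1,2), of d] mdist_pos_less[OF y(3)] y(1,2) assms(3)
      by (meson less_le_trans subsetD)
    show ?thesis
      using homogeneous_hullD(5)[OF hull z]
    proof
      assume "z \<in> Y"
      \<comment> \<open>The point \<open>z\<close> is its own witness, as its distance zero to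
        itself lies below the positive diameter.\<close>
      then show ?thesis using pos assms(3) by (intro bexI[of _ z]) auto
    next
      assume "\<exists>y\<in>Y. \<exists>y1\<in>Y. \<exists>y2\<in>Y. d z y < d y1 y2"
      then show ?thesis
        using dist_le_mdiameter[OF assms(2), of _ _ d] by (meson less_le_trans)
    qed
  qed
  show ?thesis
    by (intro exI[of _ Z] conjI allI impI ballI Z) (use ext near in auto)
qed

end
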